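(* Let $F=\hat f+\tau\hat g$ on $\mathcal{R}^n$ have a minimizer $x^*$. Let $\lambda_0=1$ and $\lambda_k=\prod_{i=0}^{k-1}(1-\alpha_i)$, where $\alpha_i$ are the coefficients produced by the COMET algorithm. Then COMET generates a sequence of points $\{x_k\}_{k=0}^\infty$ such that for all $k$ $$F(x_k)-F(x^* )\le\lambda_k\left[F(x_0)-F(x^* )+\frac{\gamma_0}{2}\|x_0-x^*\|^2\right].$$
   Context: Setting: $\|\cdot\|$ is the Euclidean norm. $f:\mathcal{R}^n\to\mathcal{R}$ is $L_f$-smooth and $\mu_f$-strongly convex, $0\le\mu_f\le L_f$; $g:\mathcal{R}^n\to\mathcal{R}$ is convex, lower semi-continuous, with strong convexity parameter $\mu_g\ge0$; $\tau>0$; $F=f+\tau g$. With $x_0\in\mathcal{R}^n$, put $\hat f(x)=f(x)+\frac{\tau\mu_g}{2}\|x-x_0\|^2$ and $\hat g(x)=g(x)-\frac{\mu_g}{2}\|x-x_0\|^2$, so $F=\hat f+\tau\hat g$, $\hat f$ is $L_{\hat f}$-smooth and $\mu_{\hat f}$-strongly convex with $L_{\hat f}=L_f+\tau\mu_g$, $\mu_{\hat f}=\mu_f+\tau\mu_g$, and $\hat g$ is convex. For $L>0$: $m_L(y;x)=\hat f(y)+\nabla\hat f(y)^T(x-y)+\frac L2\|x-y\|^2+\tau\hat g(x)$ and $T_L(y)=\arg\min_{x\in\mathcal{R}^n}m_L(y;x)$. COMET algorithm. Input: $x_0\in\mathcal{R}^n$, $L_0>0$, $\gamma_0\in[0,3L_0+\mu_{\hat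 f}]$, $\eta_u>1$, $\eta_d\in(0,1)$; set $v_0=x_0$. ($\gamma_0$ and $\mu_{\hat f}$ not both zero, so that all quotients are defined.) At iteration $k=0,1,2,\dots$, for $i=0,1,2,\dots$ with $\hat L_i=\eta_u^i\eta_dL_k$ compute $$\hat\alpha_i=\frac{(\mu_{\hat f}-\gamma_k)+\sqrt{(\mu_{\hat f}-\gamma_k)^2+4\hat L_i\gamma_k}}{2\hat L_i},\qquad\hat\gamma_{i+1}=(1-\hat\alpha_i)\gamma_k+\hat\alpha_i\mu_{\hat f},$$ $$\hat y_i=\frac{\hat\gamma_{i+1}x_k+\hat\alpha_i\gamma_kv_k}{\hat\gamma_{i+1}+\hat\alpha_i\gamma_k},\qquad\hat x_{i+1}=T_{\hat L_i}(\hat y_i),$$ $$\hat v_{i+1}=\frac{1}{\hat\gamma_{i+1}}\Big((1-\hat\alpha_i)\gamma_kv_k+\hat\alpha_i\big(\mu_{\hat f}\hat y_i-\hat L_i(\hat y_i-\hat x_{i+1})\big)\Big),$$ stopping at the first $i$ with $F(\hat x_{i+1})\le m_{\hat L_i}(\hat y_i;\hat x_{i+1})$. For that $i$ set $L_{k+1}=\hat L_i$, $x_{k+1}=\hat x_{i+1}$, $v_{k+1}=\hat v_{i+1}$, $\gamma_{k+1}=\hat\gamma_{i+1}$, $\alpha_k=\hat\alpha_i$, $y_k=\hat y_i$.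
   Formalization: The bound for k is claimed unless some earlier iteration j<k had α_j>1, in which case y_j=x_{j+1} and x_{j+1} is an exact minimizer of F; without this exception λ_k can be negative and the claim false. *)

theory Defs
  imports "HOL-Analysis.Analysis"
begin

definition grad :: "('a::real_inner \<Rightarrow> real) \<Rightarrow> 'a \<Rightarrow> 'a" where
  "grad f x = (THE d. GDERIV f x :> d)"

definition smooth_fun :: "real \<Rightarrow> ('a::real_inner \<Rightarrow> real) \<Rightarrow> bool" where
  "smooth_fun L f \<longleftrightarrow> (\<forall>x. f differentiable (at x)) \<and> L-lipschitz_on UNIV (grad f)"

text \<open>The defining inequality does not use differentiability, so that it applies both to the
  smooth and to the nonsmooth term of the objective; the modulus 0 is plain convexity.\<close>

definition strongly_convex :: "real \<Rightarrow> ('a::real_normed_vector \<Rightarrow> real) \<Rightarrow> bool" where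
  "strongly_convex \<mu> f \<longleftrightarrow> (\<forall>x y. \<forall>t\<in>{0..1}.
     f ((1 - t) *\<^sub>R x + t *\<^sub>R y)
       \<le> (1 - t) * f x + t * f y - \<mu> / 2 * t * (1 - t) * (norm (x - y))\<^sup>2)"

definition lower_semicontinuous :: "('a::topological_space \<Rightarrow> real) \<Rightarrow> bool" where
  "lower_semicontinuous f \<longleftrightarrow> (\<forall>x. \<forall>c < f x. eventually (\<lambda>y. c < f y) (nhds x))"

abbreviation minimizer :: "('a \<Rightarrow> real) \<Rightarrow> 'a \<Rightarrow> bool" where
  "minimizer h x \<equiv> is_arg_min h (\<lambda>_. True) x"

context
  fixes f g :: "real^'n \<Rightarrow> real" and \<tau> \<mu>f \<mu>g :: real and x0 :: "real^'n"
begin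

definition objective :: "real^'n \<Rightarrow> real" where
  "objective x = f x + \<tau> * g x"

text \<open>The strong convexity of \<open>g\<close> is moved into the smooth term by a quadratic centred at the
  starting point; \<open>f_hat x + \<tau> * g_hat x = objective x\<close>.\<close>

definition f_hat :: "real^'n \<Rightarrow> real" where
  "f_hat x = f x + \<tau> * \<mu>g / 2 * (norm (x - x0))\<^sup>2"

definition g_hat :: "real^'n \<Rightarrow> real" where
  "g_hat x = g x - \<mu>g / 2 * (norm (x - x0))\<^sup>2"

definition mu_hat :: real where
  "mu_hat = \<mu>f + \<tau> * \<mu>g"

definition model :: "real \<Rightarrow> real^'n \<Rightarrow> real^'n \<Rightarrow> real" where
  "model L y x = f_hat y + grad f_hat y \<bullet> (x - y) + L / 2 * (norm (x - y))\<^sup>2 + \<tau> * g_hat x"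

definition prox_step :: "real \<Rightarrow> real^'n \<Rightarrow> real^'n" where
  "prox_step L y = (ARG_MIN (model L y) x. True)"

text \<open>Candidate quantities computed from the current \<open>\<gamma>\<close>, \<open>x\<close>, \<open>v\<close> and a trial value \<open>L\<close>
  of the line search.\<close>

definition trial_alpha :: "real \<Rightarrow> real \<Rightarrow> real" where
  "trial_alpha L \<gamma> =
     ((mu_hat - \<gamma>) + sqrt ((mu_hat - \<gamma>)\<^sup>2 + 4 * L * \<gamma>)) / (2 * L)"

definition trial_gamma :: "real \<Rightarrow> real \<Rightarrow> real" where
  "trial_gamma L \<gamma> = (1 - trial_alpha L \<gamma>) * \<gamma> + trial_alpha L \<gamma> * mu_hat"

definition trial_y :: "real \<Rightarrow> real \<Rightarrow> real^'n \<Rightarrow> real^'n \<Rightarrow> real^'n" where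
  "trial_y L \<gamma> x v =
     (1 / (trial_gamma L \<gamma> + trial_alpha L \<gamma> * \<gamma>)) *\<^sub>R
       (trial_gamma L \<gamma> *\<^sub>R x + (trial_alpha L \<gamma> * \<gamma>) *\<^sub>R v)"

definition trial_x :: "real \<Rightarrow> real \<Rightarrow> real^'n \<Rightarrow> real^'n \<Rightarrow> real^'n" where
  "trial_x L \<gamma> x v = prox_step L (trial_y L \<gamma> x v)"

definition trial_v :: "real \<Rightarrow> real \<Rightarrow> real^'n \<Rightarrow> real^'n \<Rightarrow> real^'n" where
  "trial_v L \<gamma> x v =
     (1 / trial_gamma L \<gamma>) *\<^sub>R
       (((1 - trial_alpha L \<gamma>) * \<gamma>) *\<^sub>R v
        + trial_alpha L \<gamma> *\<^sub>R
            (mu_hat *\<^sub>R trial_y L \<gamma> x v - L *\<^sub>R (trial_y L \<gamma> x v - trial_x L \<gamma> x v)))"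

definition accepted :: "real \<Rightarrow> real \<Rightarrow> real^'n \<Rightarrow> real^'n \<Rightarrow> bool" where
  "accepted L \<gamma> x v \<longleftrightarrow>
     objective (trial_x L \<gamma> x v) \<le> model L (trial_y L \<gamma> x v) (trial_x L \<gamma> x v)"

text \<open>The sequences are those of an infinite execution of the algorithm; in particular every
  line search terminates, \<open>i\<close> being the first index whose trial is accepted.\<close>

definition comet_run ::
  "real \<Rightarrow> real \<Rightarrow> real \<Rightarrow> real \<Rightarrow> (nat \<Rightarrow> real^'n) \<Rightarrow> (nat \<Rightarrow> real^'n) \<Rightarrow> (nat \<Rightarrow> real^'n) \<Rightarrow>
   (nat \<Rightarrow> real) \<Rightarrow> (nat \<Rightarrow> real) \<Rightarrow> (nat \<Rightarrow> real) \<Rightarrow> bool" where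
  "comet_run L0 \<gamma>0 \<eta>u \<eta>d x y v L \<gamma> \<alpha> \<longleftrightarrow>
     x 0 = x0 \<and> v 0 = x0 \<and> L 0 = L0 \<and> \<gamma> 0 = \<gamma>0 \<and>
     (\<forall>k. \<exists>i::nat.
        accepted (\<eta>u ^ i * \<eta>d * L k) (\<gamma> k) (x k) (v k) \<and>
        (\<forall>j<i. \<not> accepted (\<eta>u ^ j * \<eta>d * L k) (\<gamma> k) (x k) (v k)) \<and>
        L (Suc k) = \<eta>u ^ i * \<eta>d * L k \<and>
        x (Suc k) = trial_x (L (Suc k)) (\<gamma> k) (x k) (v k) \<and>
        v (Suc k) = trial_v (L (Suc k)) (\<gamma> k) (x k) (v k) \<and>
        \<gamma> (Suc k) = trial_gamma (L (Suc k)) (\<gamma> k) \<and>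
        \<alpha> k = trial_alpha (L (Suc k)) (\<gamma> k) \<and>
        y k = trial_y (L (Suc k)) (\<gamma> k) (x k) (v k))"

end

end

theory Submission
  imports Defs
begin

text \<open>
  Write \<open>F\<close> for the objective and \<open>\<mu>\<close> for the modulus of \<open>f_hat\<close>. Everything rests on one
  inequality. If the trial with estimate \<open>L\<close> is accepted at \<open>y\<close> and \<open>x'\<close> is its proximal point,
  then for every \<open>w\<close>
  \<open>F w \<ge> F x' + L/2 |w - x'|\<^sup>2 - L/2 |w - y|\<^sup>2 + \<mu>/2 |w - y|\<^sup>2\<close>.
  It combines three facts: \<open>f_hat\<close> lies above its tangent by \<open>\<mu>/2 |w - y|\<^sup>2\<close>, the model is
  \<open>L\<close>-strongly convex and so grows by \<open>L/2 |w - x'|\<^sup>2\<close> away from its minimizer, and acceptance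
  says that the model is at least \<open>F\<close> at \<open>x'\<close> (lemma \<open>accepted_lower_bound\<close>).

  The coefficient \<open>\<alpha>\<close> is the larger root of \<open>L \<alpha>\<^sup>2 = (1 - \<alpha>) \<gamma> + \<alpha> \<mu>\<close>, which is at
  most \<open>1\<close> exactly when \<open>L \<ge> \<mu>\<close>. In that case, taking the inequality at \<open>w = x\<close> and at
  \<open>w = x*\<close> with weights \<open>1 - \<alpha>\<close> and \<open>\<alpha>\<close> shows that the potential
  \<open>F x - F x* + \<gamma>/2 |v - x*|\<^sup>2\<close> shrinks by the factor \<open>1 - \<alpha>\<close> in one iteration (lemma
  \<open>potential_contraction\<close>): \<open>v\<close> is updated so that the squares of the gradient mapping
  \<open>L (y - x')\<close> cancel, and \<open>y\<close> is chosen so that the terms linear in it cancel. Multiplying the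
  factors gives the rate.

  When \<open>L < \<mu>\<close>, the curvature of the model is smaller than that of \<open>f_hat\<close>, so acceptance is only
  possible if \<open>x' = y\<close>; a fixed point of the proximal step minimizes \<open>F\<close> (lemma
  \<open>accepted_small_estimate\<close>).

  Minimizers of the model exist because a continuous strongly convex function is coercive, and
  infinite executions exist because, by the descent lemma, every \<open>L \<ge> Lf + \<tau> \<mu>g\<close> is accepted, so
  that the geometrically growing trial values end each line search.
\<close>

section \<open>Strongly convex functions\<close>

lemma strongly_convexD:
  assumes "strongly_convex \<mu> h" "0 \<le> t" "t \<le> 1"
  shows "h ((1 - t) *\<^sub>R x + t *\<^sub>R y)
           \<le> (1 - t) * h x + t * h y - \<mu> / 2 * t * (1 - t) * (norm (x - y))\<^sup>2"
  using assms by (auto simp: strongly_convex_def)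

lemma strongly_convex_0_imp_convex_on: "strongly_convex 0 h \<Longrightarrow> convex_on UNIV h"
  by (rule convex_onI) (use strongly_convexD[of 0 h] in fastforce)+

lemma norm_convex_combination_sq:
  fixes p q :: "'a::real_inner"
  shows "(norm ((1 - t) *\<^sub>R p + t *\<^sub>R q))\<^sup>2
           = (1 - t) * (norm p)\<^sup>2 + t * (norm q)\<^sup>2 - t * (1 - t) * (norm (p - q))\<^sup>2"
  unfolding power2_norm_eq_inner
  by (simp add: inner_simps inner_commute) algebra

text \<open>The squared distance satisfies the defining inequality of strong convexity with equality, so
  the modulus can be shifted by a quadratic in both directions: \<open>c\<close> may be negative.\<close>

lemma strongly_convex_add_quadratic:
  fixes h :: "'a::real_inner \<Rightarrow> real"
  assumes "strongly_convex \<mu> h"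
  shows "strongly_convex (\<mu> + c) (\<lambda>x. h x + c / 2 * (norm (x - a))\<^sup>2)"
  unfolding strongly_convex_def
proof (intro allI ballI)
  fix x y :: 'a and t :: real
  assume t: "t \<in> {0..1}"
  have "(1 - t) *\<^sub>R x + t *\<^sub>R y - a = (1 - t) *\<^sub>R (x - a) + t *\<^sub>R (y - a)"
    by (simp add: algebra_simps)
  then have sq: "(norm ((1 - t) *\<^sub>R x + t *\<^sub>R y - a))\<^sup>2
      = (1 - t) * (norm (x - a))\<^sup>2 + t * (norm (y - a))\<^sup>2 - t * (1 - t) * (norm (x - y))\<^sup>2"
    by (simp add: norm_convex_combination_sq)
  show "h ((1 - t) *\<^sub>R x + t *\<^sub>R y) + c / 2 * (norm ((1 - t) *\<^sub>R x + t *\<^sub>R y - a))\<^sup>2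
      \<le> (1 - t) * (h x + c / 2 * (norm (x - a))\<^sup>2) + t * (h y + c / 2 * (norm (y - a))\<^sup>2)
          - (\<mu> + c) / 2 * t * (1 - t) * (norm (x - y))\<^sup>2"
    using strongly_convexD[OF assms, of t x y] t unfolding sq by (simp add: field_simps)
qed

lemma strongly_convex_scale:
  assumes "strongly_convex \<mu> h" "0 \<le> c"
  shows "strongly_convex (c * \<mu>) (\<lambda>x. c * h x)"
  unfolding strongly_convex_def
proof (intro allI ballI)
  fix x y :: 'a and t :: real
  assume "t \<in> {0..1}"
  then have "c * h ((1 - t) *\<^sub>R x + t *\<^sub>R y)
      \<le> c * ((1 - t) * h x + t * h y - \<mu> / 2 * t * (1 - t) * (norm (x - y))\<^sup>2)"
    using assms by (intro mult_left_mono strongly_convexD) auto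
  then show "c * h ((1 - t) *\<^sub>R x + t *\<^sub>R y)
      \<le> (1 - t) * (c * h x) + t * (c * h y) - c * \<mu> / 2 * t * (1 - t) * (norm (x - y))\<^sup>2"
    by (simp add: algebra_simps)
qed

lemma strongly_convex_add_affine:
  fixes h :: "'a::real_inner \<Rightarrow> real"
  assumes "strongly_convex \<mu> h"
  shows "strongly_convex \<mu> (\<lambda>x. b + d \<bullet> (x - a) + h x)"
  unfolding strongly_convex_def
proof (intro allI ballI)
  fix x y :: 'a and t :: real
  assume t: "t \<in> {0..1}"
  show "b + d \<bullet> ((1 - t) *\<^sub>R x + t *\<^sub>R y - a) + h ((1 - t) *\<^sub>R x + t *\<^sub>R y)
      \<le> (1 - t) * (b + d \<bullet> (x - a) + h x) + t * (b + d \<bullet> (y - a) + h y)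
          - \<mu> / 2 * t * (1 - t) * (norm (x - y))\<^sup>2"
    using strongly_convexD[OF assms, of t x y] t by (simp add: inner_simps algebra_simps)
qed

text \<open>Compare the minimizer with the points of the segment towards \<open>x\<close>: dividing by the step length
  \<open>t\<close> and letting \<open>t\<close> tend to \<open>0\<close> leaves the full quadratic term.\<close>

lemma strongly_convex_minimizer_growth:
  assumes sc: "strongly_convex \<mu> h" and min: "minimizer h z"
  shows "h z + \<mu> / 2 * (norm (x - z))\<^sup>2 \<le> h x"
proof -
  have bound: "h z + \<mu> / 2 * (1 - t) * (norm (x - z))\<^sup>2 \<le> h x" if t: "0 < t" "t < 1" for t :: real
  proof -
    have "h z \<le> h ((1 - t) *\<^sub>R z + t *\<^sub>R x)"
      using min by (auto simp: is_arg_min_linorder)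
    also have "\<dots> \<le> (1 - t) * h z + t * h x - \<mu> / 2 * t * (1 - t) * (norm (x - z))\<^sup>2"
      using strongly_convexD[OF sc, of t z x] t by (simp add: norm_minus_commute)
    finally have "t * (h z + \<mu> / 2 * (1 - t) * (norm (x - z))\<^sup>2) \<le> t * h x"
      by (simp add: algebra_simps)
    then show ?thesis
      using t by simp
  qed
  have "((\<lambda>t. h z + \<mu> / 2 * (1 - t) * (norm (x - z))\<^sup>2)
      \<longlongrightarrow> h z + \<mu> / 2 * (1 - 0) * (norm (x - z))\<^sup>2) (at_right 0)"
    by (intro tendsto_intros)
  moreover have "eventually (\<lambda>t. h z + \<mu> / 2 * (1 - t) * (norm (x - z))\<^sup>2 \<le> h x) (at_right (0::real))"
    using bound by (auto intro!: eventually_at_rightI[of 0 1])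
  ultimately show ?thesis
    using tendsto_upperbound[of _ _ "at_right (0::real)"] by fastforce
qed

text \<open>Coercivity: if \<open>m\<close> is the minimum of \<open>h\<close> over the unit ball around \<open>0\<close>, strong convexity along
  the ray through a point at distance \<open>r \<ge> 1\<close> forces a value of at least
  \<open>h 0 + r (m - h 0) + \<mu>/2 r (r - 1)\<close> there, which exceeds \<open>h 0\<close> for large \<open>r\<close>. So minimizing over
  a large ball suffices.\<close>

lemma strongly_convex_ex1_minimizer:
  fixes h :: "'a::euclidean_space \<Rightarrow> real"
  assumes sc: "strongly_convex \<mu> h" and "0 < \<mu>" and cont: "continuous_on UNIV h"
  shows "\<exists>!z. minimizer h z"
proof (rule ex_ex1I)
  have attained: "\<exists>p\<in>cball 0 r. \<forall>x\<in>cball 0 r. h p \<le> h x" if "0 \<le> r" for r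
    using that by (intro continuous_attains_inf continuous_on_subset[OF cont]) auto
  obtain p where "\<forall>x\<in>cball 0 1. h p \<le> h x"
    using attained[of 1] by auto
  then have p: "h p \<le> h x" if "norm x \<le> 1" for x
    using that by simp
  define R where "R = 2 / \<mu> * (h 0 - h p) + 1"
  have R1: "1 \<le> R"
    using p[of 0] \<open>0 < \<mu>\<close> by (simp add: R_def)
  have far: "h 0 \<le> h x" if "R \<le> norm x" for x
  proof -
    define r where "r = norm x"
    have r: "R \<le> r" "1 \<le> r"
      using that R1 by (auto simp: r_def)
    have r1: "0 \<le> 1 / r" "1 / r \<le> 1"
      using r by simp_all
    have "h p \<le> h ((1 - 1 / r) *\<^sub>R 0 + (1 / r) *\<^sub>R x)"
      using p r by (simp add: r_def)
    also have "\<dots> \<le> (1 - 1 / r) * h 0 + 1 / r * h x - \<mu> / 2 * (1 / r) * (1 - 1 / r) * r\<^sup>2"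
      using strongly_convexD[OF sc r1, of 0 x] by (simp add: r_def)
    finally have "r * h p
        \<le> r * ((1 - 1 / r) * h 0 + 1 / r * h x - \<mu> / 2 * (1 / r) * (1 - 1 / r) * r\<^sup>2)"
      using r by (intro mult_left_mono) auto
    also have "\<dots> = (r - 1) * h 0 + h x - \<mu> / 2 * r * (r - 1)"
      using r by (simp add: field_simps power2_eq_square)
    finally have "h 0 + r * (\<mu> / 2 * (r - 1) - (h 0 - h p)) \<le> h x"
      by (simp add: algebra_simps)
    moreover have "h 0 - h p \<le> \<mu> / 2 * (r - 1)"
      using r \<open>0 < \<mu>\<close> by (simp add: R_def field_simps)
    then have "0 \<le> r * (\<mu> / 2 * (r - 1) - (h 0 - h p))"
      using r by (intro mult_nonneg_nonneg) auto
    ultimately show ?thesis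
      by linarith
  qed
  obtain z where "\<forall>x\<in>cball 0 R. h z \<le> h x"
    using attained[of R] R1 by auto
  then have z: "h z \<le> h x" if "norm x \<le> R" for x
    using that by simp
  have "h z \<le> h x" for x
    using z[of x] z[of 0] far[of x] R1 by (cases "norm x \<le> R") auto
  then show "\<exists>z. minimizer h z"
    by (auto simp: is_arg_min_linorder)
next
  fix z w
  assume "minimizer h z" "minimizer h w"
  from strongly_convex_minimizer_growth[OF sc this(1), of w]
       strongly_convex_minimizer_growth[OF sc this(2), of z]
  have "\<mu> * (norm (w - z))\<^sup>2 \<le> 0"
    by (simp add: norm_minus_commute)
  then show "z = w"
    using \<open>0 < \<mu>\<close> by (simp add: mult_le_0_iff)
qed

section \<open>Gradients\<close>

lemma grad_eqI:
  fixes f :: "'a::real_inner \<Rightarrow> real"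
  assumes "GDERIV f x :> d"
  shows "grad f x = d"
  unfolding grad_def
proof (rule the_equality)
  show "GDERIV f x :> d"
    by (rule assms)
  show "e = d" if "GDERIV f x :> e" for e
    using has_derivative_unique[OF that[unfolded gderiv_def] assms[unfolded gderiv_def]]
    by (simp add: fun_eq_iff vector_eq_ldot)
qed

lemma GDERIV_grad:
  fixes f :: "'a::euclidean_space \<Rightarrow> real"
  assumes "f differentiable (at x)"
  shows "GDERIV f x :> grad f x"
proof -
  obtain D where D: "(f has_derivative D) (at x)"
    using assms by (auto simp: differentiable_def)
  \<comment> \<open>The adjoint of the functional \<open>D\<close>, applied to \<open>1\<close>, represents \<open>D\<close>.\<close>
  have "h \<bullet> adjoint D 1 = D h" for h
    using adjoint_works[OF has_derivative_linear[OF D], of h 1] by simp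
  then have "GDERIV f x :> adjoint D 1"
    using D by (simp add: gderiv_def)
  then show ?thesis
    by (simp add: grad_eqI)
qed

lemma GDERIV_has_real_derivative_along_line:
  fixes f :: "'a::real_inner \<Rightarrow> real"
  assumes "GDERIV f (y + t *\<^sub>R u) :> d"
  shows "((\<lambda>s. f (y + s *\<^sub>R u)) has_real_derivative (d \<bullet> u)) (at t)"
proof -
  have "((\<lambda>s. y + s *\<^sub>R u) has_derivative (\<lambda>s. s *\<^sub>R u)) (at t)"
    by (auto intro!: derivative_eq_intros)
  from has_derivative_compose[OF this assms[unfolded gderiv_def]] show ?thesis
    by (simp add: has_field_derivative_def inner_commute mult_commute_abs)
qed

text \<open>The difference quotient of \<open>h\<close> along the segment from \<open>y\<close> to \<open>z\<close> is bounded by strong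
  convexity and tends to the directional derivative.\<close>

lemma strongly_convex_above_tangent:
  fixes h :: "'a::real_inner \<Rightarrow> real"
  assumes sc: "strongly_convex \<mu> h" and d: "GDERIV h y :> d"
  shows "h y + d \<bullet> (z - y) + \<mu> / 2 * (norm (z - y))\<^sup>2 \<le> h z"
proof -
  let ?q = "\<lambda>t. (h (y + t *\<^sub>R (z - y)) - h y) / t"
  let ?b = "\<lambda>t. h z - h y - \<mu> / 2 * (1 - t) * (norm (z - y))\<^sup>2"
  have "?q t \<le> ?b t" if t: "0 < t" "t < 1" for t :: real
  proof -
    have "h (y + t *\<^sub>R (z - y)) = h ((1 - t) *\<^sub>R y + t *\<^sub>R z)"
      by (simp add: algebra_simps)
    also have "\<dots> \<le> (1 - t) * h y + t * h z - \<mu> / 2 * t * (1 - t) * (norm (z - y))\<^sup>2"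
      using strongly_convexD[OF sc, of t y z] t by (simp add: norm_minus_commute)
    finally have "h (y + t *\<^sub>R (z - y)) - h y \<le> t * ?b t"
      by (simp add: algebra_simps)
    then show ?thesis
      using t by (simp add: field_simps)
  qed
  then have "eventually (\<lambda>t. ?q t \<le> ?b t) (at_right 0)"
    by (intro eventually_at_rightI[of 0 1]) auto
  moreover have "(?q \<longlongrightarrow> d \<bullet> (z - y)) (at_right 0)"
  proof -
    have "(?q \<longlongrightarrow> d \<bullet> (z - y)) (at 0)"
      using GDERIV_has_real_derivative_along_line[of h y 0 "z - y" d] d
      by (simp add: has_field_derivative_iff)
    then show ?thesis
      by (rule tendsto_mono[OF at_le[OF subset_UNIV]])
  qed
  moreover have "(?b \<longlongrightarrow> h z - h y - \<mu> / 2 * (1 - 0) * (norm (z - y))\<^sup>2) (at_right 0)"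
    by (intro tendsto_intros)
  ultimately have "d \<bullet> (z - y) \<le> h z - h y - \<mu> / 2 * (1 - 0) * (norm (z - y))\<^sup>2"
    by (intro tendsto_le[where f = ?b and g = ?q and F = "at_right 0"]) auto
  then show ?thesis
    by simp
qed

text \<open>Subtracting the claimed upper bound from \<open>f\<close> along the segment gives a function whose
  derivative \<open>(grad f (y + t u) - grad f y) \<bullet> u - L t |u|\<^sup>2\<close> is nonpositive by the Lipschitz
  condition.\<close>

lemma smooth_fun_descent:
  fixes f :: "'a::euclidean_space \<Rightarrow> real"
  assumes "smooth_fun L f"
  shows "f z \<le> f y + grad f y \<bullet> (z - y) + L / 2 * (norm (z - y))\<^sup>2"
proof -
  define u where "u = z - y"
  let ?\<phi> = "\<lambda>t. f (y + t *\<^sub>R u) - t * (grad f y \<bullet> u) - L / 2 * t\<^sup>2 * (norm u)\<^sup>2"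
  have "?\<phi> 1 \<le> ?\<phi> 0"
  proof (rule DERIV_nonpos_imp_nonincreasing[where f = ?\<phi>])
    fix t :: real
    assume t: "0 \<le> t" "t \<le> 1"
    let ?D = "grad f (y + t *\<^sub>R u) \<bullet> u - grad f y \<bullet> u - L * t * (norm u)\<^sup>2"
    have "GDERIV f (y + t *\<^sub>R u) :> grad f (y + t *\<^sub>R u)"
      using assms by (simp add: smooth_fun_def GDERIV_grad)
    note GDERIV_has_real_derivative_along_line[OF this]
    then have "(?\<phi> has_real_derivative ?D) (at t)"
      by (auto intro!: derivative_eq_intros)
    moreover have "?D \<le> 0"
    proof -
      have "norm (grad f (y + t *\<^sub>R u) - grad f y) \<le> L * (t * norm u)"
        using assms lipschitz_onD[of L UNIV "grad f" "y + t *\<^sub>R u" y] t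
        by (simp add: smooth_fun_def dist_norm)
      then have "norm (grad f (y + t *\<^sub>R u) - grad f y) * norm u \<le> L * (t * norm u) * norm u"
        by (intro mult_right_mono) auto
      moreover have "(grad f (y + t *\<^sub>R u) - grad f y) \<bullet> u
          \<le> norm (grad f (y + t *\<^sub>R u) - grad f y) * norm u"
        by (rule norm_cauchy_schwarz)
      ultimately show ?thesis
        by (simp add: inner_diff_left power2_eq_square mult.assoc)
    qed
    ultimately show "\<exists>D. (?\<phi> has_real_derivative D) (at t) \<and> D \<le> 0"
      by blast
  qed simp
  then show ?thesis
    by (simp add: u_def)
qed

section \<open>The coefficients\<close>

text \<open>The quadratic formula defining \<open>\<alpha>\<close> solves \<open>L \<alpha>\<^sup>2 = (1 - \<alpha>) \<gamma> + \<alpha> \<mu>\<close>, whose right-hand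
  side is the new \<open>\<gamma>\<close>. The ratio \<open>\<alpha>\<^sup>2/\<gamma>' = 1/L\<close> is what the contraction of the potential needs.\<close>

lemma
  assumes "0 < L" "0 \<le> \<gamma>"
  shows trial_gamma_eq: "trial_gamma \<tau> \<mu>f \<mu>g L \<gamma> = L * (trial_alpha \<tau> \<mu>f \<mu>g L \<gamma>)\<^sup>2"
    and trial_alpha_nonneg: "0 \<le> trial_alpha \<tau> \<mu>f \<mu>g L \<gamma>"
proof -
  define \<mu> where "\<mu> = mu_hat \<tau> \<mu>f \<mu>g"
  define s where "s = sqrt ((\<mu> - \<gamma>)\<^sup>2 + 4 * L * \<gamma>)"
  define a where "a = trial_alpha \<tau> \<mu>f \<mu>g L \<gamma>"
  have s2: "s\<^sup>2 = (\<mu> - \<gamma>)\<^sup>2 + 4 * L * \<gamma>"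
    using assms by (simp add: s_def)
  have a: "s = 2 * L * a - (\<mu> - \<gamma>)"
    using assms by (simp add: a_def trial_alpha_def s_def \<mu>_def)
  have "4 * L * (L * a\<^sup>2) = 4 * L * ((1 - a) * \<gamma> + a * \<mu>)"
    using s2 unfolding a by (simp add: algebra_simps power2_eq_square)
  then show "trial_gamma \<tau> \<mu>f \<mu>g L \<gamma> = L * (trial_alpha \<tau> \<mu>f \<mu>g L \<gamma>)\<^sup>2"
    using assms by (simp add: trial_gamma_def \<mu>_def a_def)
  have "\<bar>\<mu> - \<gamma>\<bar> \<le> s"
    unfolding s_def using assms by (intro real_le_rsqrt) simp
  then show "0 \<le> trial_alpha \<tau> \<mu>f \<mu>g L \<gamma>"
    using assms by (simp add: trial_alpha_def s_def \<mu>_def)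
qed

lemma trial_gamma_nonneg:
  assumes "0 < L" "0 \<le> \<gamma>"
  shows "0 \<le> trial_gamma \<tau> \<mu>f \<mu>g L \<gamma>"
  using assms by (simp add: trial_gamma_eq)

lemma trial_gamma_pos:
  assumes "0 < L" "0 \<le> \<gamma>" "0 \<le> mu_hat \<tau> \<mu>f \<mu>g" "\<not> (\<gamma> = 0 \<and> mu_hat \<tau> \<mu>f \<mu>g = 0)"
  shows "0 < trial_gamma \<tau> \<mu>f \<mu>g L \<gamma>"
proof -
  have "trial_alpha \<tau> \<mu>f \<mu>g L \<gamma> \<noteq> 0"
  proof
    assume 0: "trial_alpha \<tau> \<mu>f \<mu>g L \<gamma> = 0"
    with trial_gamma_eq[OF assms(1,2), of \<tau> \<mu>f \<mu>g] have "\<gamma> = 0"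
      by (simp add: trial_gamma_def)
    with 0 assms show False
      by (simp add: trial_alpha_def)
  qed
  then show ?thesis
    using assms by (simp add: trial_gamma_eq)
qed

text \<open>For \<open>\<alpha> > 1\<close> the equation \<open>L \<alpha>\<^sup>2 = (1 - \<alpha>) \<gamma> + \<alpha> \<mu>\<close> gives \<open>L \<alpha>\<^sup>2 \<le> \<alpha> \<mu>\<close>, hence
  \<open>L < L \<alpha> \<le> \<mu>\<close>.\<close>

lemma trial_alpha_gt_1D:
  assumes "0 < L" "0 \<le> \<gamma>" "1 < trial_alpha \<tau> \<mu>f \<mu>g L \<gamma>"
  shows "L < mu_hat \<tau> \<mu>f \<mu>g"
proof -
  define a where "a = trial_alpha \<tau> \<mu>f \<mu>g L \<gamma>"
  have a: "1 < a" "L * a\<^sup>2 = (1 - a) * \<gamma> + a * mu_hat \<tau> \<mu>f \<mu>g"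
    using assms trial_gamma_eq[of L \<gamma> \<tau> \<mu>f \<mu>g] by (simp_all add: a_def trial_gamma_def)
  have "(1 - a) * \<gamma> \<le> 0"
    using a(1) assms by (intro mult_nonpos_nonneg) auto
  with a have "L * a\<^sup>2 \<le> a * mu_hat \<tau> \<mu>f \<mu>g"
    by linarith
  then have "a * (L * a) \<le> a * mu_hat \<tau> \<mu>f \<mu>g"
    by (simp only: power2_eq_square mult_ac)
  then have "L * a \<le> mu_hat \<tau> \<mu>f \<mu>g"
    using a(1) by simp
  moreover have "L * 1 < L * a"
    using a(1) assms(1) by (intro mult_strict_left_mono)
  ultimately show ?thesis
    by simp
qed

section \<open>Contraction of the potential\<close>

text \<open>With \<open>G = L (y - x')\<close> the lower bound reads
  \<open>F w \<ge> F x' + |G|\<^sup>2/(2 L) + G \<bullet> (w - y) + \<mu>/2 |w - y|\<^sup>2\<close>. The new \<open>v'\<close> is \<open>p - (\<alpha>/\<gamma>') G\<close>,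
  where \<open>p\<close> is a convex combination of \<open>v\<close> and \<open>y\<close>. In \<open>\<gamma>'/2 |v' - z|\<^sup>2\<close> the square of \<open>G\<close> has the
  coefficient \<open>\<alpha>\<^sup>2/(2 \<gamma>') = 1/(2 L)\<close>, which cancels, and the inner products with \<open>G\<close> cancel because
  \<open>y\<close> is the combination of \<open>x\<close> and \<open>v\<close> with \<open>(1 - \<alpha>) (x - y) + \<alpha> (p - y) = 0\<close>.\<close>

lemma potential_contraction:
  fixes x v y x' v' z :: "'a::real_inner" and F :: "'a \<Rightarrow> real"
  assumes \<gamma>': "\<gamma>' = (1 - \<alpha>) * \<gamma> + \<alpha> * \<mu>" "\<gamma>' = L * \<alpha>\<^sup>2" "0 < \<gamma>'"
    and pos: "0 < L" "0 \<le> \<alpha>" "\<alpha> \<le> 1" "0 \<le> \<gamma>" "0 \<le> \<mu>"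
    and y: "(\<gamma>' + \<alpha> * \<gamma>) *\<^sub>R y = \<gamma>' *\<^sub>R x + (\<alpha> * \<gamma>) *\<^sub>R v"
    and v': "\<gamma>' *\<^sub>R v' = ((1 - \<alpha>) * \<gamma>) *\<^sub>R v + \<alpha> *\<^sub>R (\<mu> *\<^sub>R y - L *\<^sub>R (y - x'))"
    and lower: "\<And>w. F x' + L / 2 * (norm (w - x'))\<^sup>2 - L / 2 * (norm (w - y))\<^sup>2
                   + \<mu> / 2 * (norm (w - y))\<^sup>2 \<le> F w"
  shows "F x' - F z + \<gamma>' / 2 * (norm (v' - z))\<^sup>2
           \<le> (1 - \<alpha>) * (F x - F z + \<gamma> / 2 * (norm (v - z))\<^sup>2)"
proof -
  define G where "G = L *\<^sub>R (y - x')"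
  define t where "t = \<alpha> * \<mu> / \<gamma>'"
  define p where "p = (1 - t) *\<^sub>R v + t *\<^sub>R y"
  have t1: "\<gamma>' * t = \<alpha> * \<mu>"
    using \<gamma>'(3) by (simp add: t_def)
  moreover have "\<gamma>' * (1 - t) = \<gamma>' - \<gamma>' * t"
    by (simp add: right_diff_distrib)
  ultimately have t: "\<gamma>' * t = \<alpha> * \<mu>" "\<gamma>' * (1 - t) = (1 - \<alpha>) * \<gamma>"
    using \<gamma>'(1) by linarith+
  have "0 \<le> \<gamma>' * t" "0 \<le> \<gamma>' * (1 - t)"
    unfolding t using pos by simp_all
  then have t01: "0 \<le> t" "0 \<le> 1 - t"
    using \<gamma>'(3) by (simp_all only: zero_le_mult_iff) linarith+
  have \<alpha>2: "\<alpha>\<^sup>2 / \<gamma>' = 1 / L"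
    using \<gamma>'(2,3) pos by (cases "\<alpha> = 0") (simp_all add: field_simps)
  have lowerG: "F x' + (norm G)\<^sup>2 / (2 * L) + G \<bullet> (w - y) + \<mu> / 2 * (norm (w - y))\<^sup>2 \<le> F w" for w
  proof -
    have "w - x' = (w - y) + (1 / L) *\<^sub>R G"
      using pos by (simp add: G_def)
    then have "L / 2 * (norm (w - x'))\<^sup>2
        = L / 2 * (norm (w - y))\<^sup>2 + G \<bullet> (w - y) + (norm G)\<^sup>2 / (2 * L)"
      using pos unfolding power2_norm_eq_inner
      by (simp add: inner_simps inner_commute field_simps power2_eq_square)
    then show ?thesis
      using lower[of w] by linarith
  qed
  have linear: "(1 - \<alpha>) *\<^sub>R (x - y) + \<alpha> *\<^sub>R (p - y) = 0"
  proof -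
    have "p - y = (1 - t) *\<^sub>R (v - y)"
      by (simp add: p_def algebra_simps)
    then have "\<gamma>' *\<^sub>R ((1 - \<alpha>) *\<^sub>R (x - y) + \<alpha> *\<^sub>R (p - y))
        = ((1 - \<alpha>) * \<gamma>') *\<^sub>R (x - y) + (\<alpha> * (\<gamma>' * (1 - t))) *\<^sub>R (v - y)"
      by (simp add: scaleR_add_right mult_ac)
    also have "\<dots> = (1 - \<alpha>) *\<^sub>R (\<gamma>' *\<^sub>R x + (\<alpha> * \<gamma>) *\<^sub>R v - (\<gamma>' + \<alpha> * \<gamma>) *\<^sub>R y)"
      unfolding t(2) by (simp add: algebra_simps)
    also have "\<dots> = 0"
      by (simp add: y)
    finally show ?thesis
      using \<gamma>'(3) by simp
  qed
  have cross: "(1 - \<alpha>) * (G \<bullet> (x - y)) + \<alpha> * (G \<bullet> (z - y)) + \<alpha> * (G \<bullet> (p - z)) = 0"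
    using arg_cong[OF linear, of "\<lambda>u. G \<bullet> u"] by (simp add: inner_simps algebra_simps)
  have "\<gamma>' *\<^sub>R v' = \<gamma>' *\<^sub>R (p - (\<alpha> / \<gamma>') *\<^sub>R G)"
    using \<gamma>'(3) unfolding v' p_def scaleR_diff_right scaleR_add_right scaleR_scaleR t
    by (simp add: G_def algebra_simps)
  then have "v' - z = (p - z) - (\<alpha> / \<gamma>') *\<^sub>R G"
    using \<gamma>'(3) by simp
  moreover have "(norm ((p - z) - c *\<^sub>R G))\<^sup>2
      = (norm (p - z))\<^sup>2 - 2 * c * (G \<bullet> (p - z)) + c\<^sup>2 * (norm G)\<^sup>2" for c
    unfolding power2_norm_eq_inner
    by (simp add: inner_simps inner_commute algebra_simps power2_eq_square)
  ultimately have "(norm (v' - z))\<^sup>2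
      = (norm (p - z))\<^sup>2 - 2 * (\<alpha> / \<gamma>') * (G \<bullet> (p - z)) + (\<alpha> / \<gamma>')\<^sup>2 * (norm G)\<^sup>2"
    by metis
  then have "\<gamma>' / 2 * (norm (v' - z))\<^sup>2
      = \<gamma>' / 2 * (norm (p - z))\<^sup>2 - \<alpha> * (G \<bullet> (p - z)) + \<alpha>\<^sup>2 / \<gamma>' / 2 * (norm G)\<^sup>2"
    using \<gamma>'(3) by (simp add: field_simps power2_eq_square)
  then have v'z: "\<gamma>' / 2 * (norm (v' - z))\<^sup>2
      = \<gamma>' / 2 * (norm (p - z))\<^sup>2 - \<alpha> * (G \<bullet> (p - z)) + (norm G)\<^sup>2 / (2 * L)"
    unfolding \<alpha>2 by simp
  have "p - z = (1 - t) *\<^sub>R (v - z) + t *\<^sub>R (y - z)"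
    by (simp add: p_def algebra_simps)
  then have "(norm (p - z))\<^sup>2 \<le> (1 - t) * (norm (v - z))\<^sup>2 + t * (norm (y - z))\<^sup>2"
    using t01 by (simp add: norm_convex_combination_sq)
  then have "\<gamma>' / 2 * (norm (p - z))\<^sup>2
      \<le> \<gamma>' / 2 * ((1 - t) * (norm (v - z))\<^sup>2 + t * (norm (y - z))\<^sup>2)"
    using \<gamma>'(3) by (intro mult_left_mono) auto
  also have "\<dots> = \<gamma>' * (1 - t) / 2 * (norm (v - z))\<^sup>2 + \<gamma>' * t / 2 * (norm (y - z))\<^sup>2"
    by (simp add: field_simps)
  finally have pz: "\<gamma>' / 2 * (norm (p - z))\<^sup>2
      \<le> (1 - \<alpha>) * \<gamma> / 2 * (norm (v - z))\<^sup>2 + \<alpha> * \<mu> / 2 * (norm (z - y))\<^sup>2"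
    unfolding t by (simp add: norm_minus_commute)
  have "0 \<le> \<mu> / 2 * (norm (x - y))\<^sup>2"
    using pos by simp
  then have "F x' + (norm G)\<^sup>2 / (2 * L) + G \<bullet> (x - y) \<le> F x"
    using lowerG[of x] by linarith
  then have "(1 - \<alpha>) * (F x' + (norm G)\<^sup>2 / (2 * L) + G \<bullet> (x - y)) \<le> (1 - \<alpha>) * F x"
    using pos by (intro mult_left_mono) auto
  moreover have "\<alpha> * (F x' + (norm G)\<^sup>2 / (2 * L) + G \<bullet> (z - y) + \<mu> / 2 * (norm (z - y))\<^sup>2) \<le> \<alpha> * F z"
    using lowerG[of z] pos by (intro mult_left_mono)
  ultimately have "F x' + (norm G)\<^sup>2 / (2 * L)
        + ((1 - \<alpha>) * (G \<bullet> (x - y)) + \<alpha> * (G \<bullet> (z - y))) + \<alpha> * \<mu> / 2 * (norm (z - y))\<^sup>2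
      \<le> (1 - \<alpha>) * F x + \<alpha> * F z"
    by (simp add: distrib_left left_diff_distrib diff_divide_distrib)
  then have "F x' - F z + \<gamma>' / 2 * (norm (v' - z))\<^sup>2
      \<le> (1 - \<alpha>) * F x + \<alpha> * F z - F z + (1 - \<alpha>) * \<gamma> / 2 * (norm (v - z))\<^sup>2"
    using v'z pz cross by linarith
  also have "\<dots> = (1 - \<alpha>) * (F x - F z + \<gamma> / 2 * (norm (v - z))\<^sup>2)"
    by (simp add: field_simps)
  finally show ?thesis .
qed

section \<open>One iteration\<close>

locale composite_problem =
  fixes f g :: "real^'n \<Rightarrow> real" and Lf \<mu>f \<mu>g \<tau> :: real and x0 :: "real^'n"
  assumes \<mu>f_nonneg: "0 \<le> \<mu>f" and \<mu>g_nonneg: "0 \<le> \<mu>g" and \<tau>_pos: "0 < \<tau>"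
    and smooth_f: "smooth_fun Lf f" and convex_f: "strongly_convex \<mu>f f"
    and convex_g: "strongly_convex \<mu>g g"
begin

abbreviation "F \<equiv> objective f g \<tau>"
abbreviation "M \<equiv> model f g \<tau> \<mu>g x0"
abbreviation "fh \<equiv> f_hat f \<tau> \<mu>g x0"
abbreviation "gh \<equiv> g_hat g \<mu>g x0"
abbreviation "\<mu> \<equiv> mu_hat \<tau> \<mu>f \<mu>g"

lemma mu_hat_nonneg: "0 \<le> \<mu>"
  using \<mu>f_nonneg \<mu>g_nonneg \<tau>_pos by (simp add: mu_hat_def)

lemma objective_split: "F x = fh x + \<tau> * gh x"
  by (simp add: objective_def f_hat_def g_hat_def algebra_simps)

lemma strongly_convex_f_hat: "strongly_convex \<mu> fh"
  using strongly_convex_add_quadratic[OF convex_f, of "\<tau> * \<mu>g" x0]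
  unfolding mu_hat_def f_hat_def[abs_def] by simp

lemma strongly_convex_g_hat: "strongly_convex 0 gh"
  using strongly_convex_add_quadratic[OF convex_g, of "- \<mu>g" x0]
  unfolding g_hat_def[abs_def] by simp

lemma grad_f_hat:
  shows GDERIV_f_hat: "GDERIV fh y :> grad fh y"
    and "grad fh y = grad f y + (\<tau> * \<mu>g) *\<^sub>R (y - x0)"
proof -
  have "(f has_derivative (\<lambda>h. h \<bullet> grad f y)) (at y)"
    using GDERIV_grad[of f y] smooth_f by (simp add: smooth_fun_def gderiv_def)
  then have "GDERIV fh y :> grad f y + (\<tau> * \<mu>g) *\<^sub>R (y - x0)"
    unfolding gderiv_def f_hat_def[abs_def] power2_norm_eq_inner
    by (auto intro!: derivative_eq_intros simp: inner_simps inner_commute algebra_simps)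
  then show "grad fh y = grad f y + (\<tau> * \<mu>g) *\<^sub>R (y - x0)" "GDERIV fh y :> grad fh y"
    using grad_eqI by metis+
qed

lemma f_hat_above_tangent:
  "fh y + grad fh y \<bullet> (z - y) + \<mu> / 2 * (norm (z - y))\<^sup>2 \<le> fh z"
  by (rule strongly_convex_above_tangent[OF strongly_convex_f_hat GDERIV_f_hat])

text \<open>The quadratic part of \<open>f_hat\<close> equals its second-order expansion, so the descent lemma for \<open>f\<close>
  carries over with the constant increased by \<open>\<tau> * \<mu>g\<close>.\<close>

lemma f_hat_descent:
  "fh z \<le> fh y + grad fh y \<bullet> (z - y) + (Lf + \<tau> * \<mu>g) / 2 * (norm (z - y))\<^sup>2"
proof -
  have "(norm (z - x0))\<^sup>2 = (norm (y - x0))\<^sup>2 + 2 * ((y - x0) \<bullet> (z - y)) + (norm (z - y))\<^sup>2"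
    unfolding power2_norm_eq_inner by (simp add: inner_simps inner_commute)
  then have "\<tau> * \<mu>g / 2 * (norm (z - x0))\<^sup>2 = \<tau> * \<mu>g / 2 * (norm (y - x0))\<^sup>2
      + \<tau> * \<mu>g * ((y - x0) \<bullet> (z - y)) + \<tau> * \<mu>g / 2 * (norm (z - y))\<^sup>2"
    by (simp add: distrib_left)
  moreover have "grad fh y \<bullet> (z - y)
      = grad f y \<bullet> (z - y) + \<tau> * \<mu>g * ((y - x0) \<bullet> (z - y))"
    by (simp add: grad_f_hat(2) inner_add_left)
  moreover have "(Lf + \<tau> * \<mu>g) / 2 * (norm (z - y))\<^sup>2
      = Lf / 2 * (norm (z - y))\<^sup>2 + \<tau> * \<mu>g / 2 * (norm (z - y))\<^sup>2"
    by (simp add: add_divide_distrib distrib_right)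
  ultimately show ?thesis
    using smooth_fun_descent[OF smooth_f, of z y] unfolding f_hat_def by linarith
qed

lemma strongly_convex_model: "strongly_convex L (M L y)"
proof -
  have "strongly_convex 0 (\<lambda>x. \<tau> * gh x)"
    using strongly_convex_scale[OF strongly_convex_g_hat, of \<tau>] \<tau>_pos by simp
  from strongly_convex_add_affine[OF strongly_convex_add_quadratic[OF this, of L y],
      of "fh y" "grad fh y" y]
  show ?thesis
    by (simp add: model_def[abs_def] algebra_simps)
qed

text \<open>The nonsmooth term is continuous because a convex function that is finite everywhere on a
  finite-dimensional space is; hence so is the model.\<close>

lemma ex1_minimizer_model:
  assumes "0 < L"
  shows "\<exists>!z. minimizer (M L y) z"
proof (rule strongly_convex_ex1_minimizer[OF strongly_convex_model assms])
  have "continuous_on UNIV gh"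
    by (intro convex_on_continuous strongly_convex_0_imp_convex_on[OF strongly_convex_g_hat]) simp
  then show "continuous_on UNIV (M L y)"
    unfolding model_def[abs_def] by (intro continuous_intros)
qed

lemma minimizer_prox_step:
  assumes "0 < L"
  shows "minimizer (M L y) (prox_step f g \<tau> \<mu>g x0 L y)"
  unfolding prox_step_def arg_min_def using ex1_minimizer_model[OF assms] by (metis someI_ex)

lemma model_above_prox_step:
  assumes "0 < L"
  shows "M L y (prox_step f g \<tau> \<mu>g x0 L y)
           + L / 2 * (norm (w - prox_step f g \<tau> \<mu>g x0 L y))\<^sup>2 \<le> M L y w"
  by (rule strongly_convex_minimizer_growth[OF strongly_convex_model minimizer_prox_step[OF assms]])

lemma model_le_objective:
  "M L y w + (\<mu> - L) / 2 * (norm (w - y))\<^sup>2 \<le> F w"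
  using f_hat_above_tangent[of y w] by (simp add: model_def objective_split field_simps)

lemma accepted_lower_bound:
  assumes "0 < L" and "accepted f g \<tau> \<mu>f \<mu>g x0 L \<gamma> x v"
  defines "y \<equiv> trial_y \<tau> \<mu>f \<mu>g L \<gamma> x v" and "x' \<equiv> trial_x f g \<tau> \<mu>f \<mu>g x0 L \<gamma> x v"
  shows "F x' + L / 2 * (norm (w - x'))\<^sup>2 - L / 2 * (norm (w - y))\<^sup>2
           + \<mu> / 2 * (norm (w - y))\<^sup>2 \<le> F w"
  using model_above_prox_step[OF assms(1), of y w] model_le_objective[of L y w] assms(2)
  by (simp add: accepted_def x'_def y_def trial_x_def field_simps)

text \<open>Taking \<open>w = x'\<close> in the lower bound leaves \<open>(\<mu> - L)/2 |x' - y|\<^sup>2 \<le> 0\<close>. Once \<open>x' = y\<close>, the two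
  terms with \<open>L\<close> cancel for every \<open>w\<close>.\<close>

lemma accepted_small_estimate:
  assumes L: "0 < L" "L < \<mu>" and acc: "accepted f g \<tau> \<mu>f \<mu>g x0 L \<gamma> x v"
  shows "trial_y \<tau> \<mu>f \<mu>g L \<gamma> x v = trial_x f g \<tau> \<mu>f \<mu>g x0 L \<gamma> x v"
    and "minimizer F (trial_x f g \<tau> \<mu>f \<mu>g x0 L \<gamma> x v)"
proof -
  let ?y = "trial_y \<tau> \<mu>f \<mu>g L \<gamma> x v" and ?x' = "trial_x f g \<tau> \<mu>f \<mu>g x0 L \<gamma> x v"
  note lower = accepted_lower_bound[OF L(1) acc]
  have "(\<mu> - L) * (norm (?x' - ?y))\<^sup>2 \<le> 0"
    using lower[of ?x'] by (simp add: algebra_simps)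
  then show eq: "?y = ?x'"
    using L by (simp add: mult_le_0_iff)
  have "F ?x' \<le> F w" for w
  proof -
    have "0 \<le> \<mu> / 2 * (norm (w - ?x'))\<^sup>2"
      using mu_hat_nonneg by simp
    then show ?thesis
      using lower[of w] unfolding eq by linarith
  qed
  then show "minimizer F ?x'"
    by (simp add: is_arg_min_linorder)
qed

lemma accepted_potential_contraction:
  assumes L: "0 < L" and \<gamma>: "0 \<le> \<gamma>" "\<not> (\<gamma> = 0 \<and> \<mu> = 0)"
    and acc: "accepted f g \<tau> \<mu>f \<mu>g x0 L \<gamma> x v"
    and \<alpha>: "trial_alpha \<tau> \<mu>f \<mu>g L \<gamma> \<le> 1"
  shows "F (trial_x f g \<tau> \<mu>f \<mu>g x0 L \<gamma> x v) - F z
           + trial_gamma \<tau> \<mu>f \<mu>g L \<gamma> / 2 * (norm (trial_v f g \<tau> \<mu>f \<mu>g x0 L \<gamma> x v - z))\<^sup>2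
         \<le> (1 - trial_alpha \<tau> \<mu>f \<mu>g L \<gamma>) * (F x - F z + \<gamma> / 2 * (norm (v - z))\<^sup>2)"
proof (rule potential_contraction[where L = L and \<mu> = \<mu> and y = "trial_y \<tau> \<mu>f \<mu>g L \<gamma> x v"])
  have pos: "0 < trial_gamma \<tau> \<mu>f \<mu>g L \<gamma>"
    by (rule trial_gamma_pos[OF L \<gamma>(1) mu_hat_nonneg \<gamma>(2)])
  then show "0 < trial_gamma \<tau> \<mu>f \<mu>g L \<gamma>" .
  \<comment> \<open>The divisor in the definition of \<open>y\<close> does not vanish.\<close>
  have "0 < trial_gamma \<tau> \<mu>f \<mu>g L \<gamma> + trial_alpha \<tau> \<mu>f \<mu>g L \<gamma> * \<gamma>"
    using pos trial_alpha_nonneg[OF L \<gamma>(1), of \<tau> \<mu>f \<mu>g] \<gamma>(1)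
    by (intro add_pos_nonneg mult_nonneg_nonneg)
  then show "(trial_gamma \<tau> \<mu>f \<mu>g L \<gamma> + trial_alpha \<tau> \<mu>f \<mu>g L \<gamma> * \<gamma>) *\<^sub>R trial_y \<tau> \<mu>f \<mu>g L \<gamma> x v
      = trial_gamma \<tau> \<mu>f \<mu>g L \<gamma> *\<^sub>R x + (trial_alpha \<tau> \<mu>f \<mu>g L \<gamma> * \<gamma>) *\<^sub>R v"
    by (simp add: trial_y_def)
  show "trial_gamma \<tau> \<mu>f \<mu>g L \<gamma> *\<^sub>R trial_v f g \<tau> \<mu>f \<mu>g x0 L \<gamma> x v
      = ((1 - trial_alpha \<tau> \<mu>f \<mu>g L \<gamma>) * \<gamma>) *\<^sub>R v
        + trial_alpha \<tau> \<mu>f \<mu>g L \<gamma> *\<^sub>R (\<mu> *\<^sub>R trial_y \<tau> \<mu>f \<mu>g L \<gamma> x v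
            - L *\<^sub>R (trial_y \<tau> \<mu>f \<mu>g L \<gamma> x v - trial_x f g \<tau> \<mu>f \<mu>g x0 L \<gamma> x v))"
    using pos by (simp add: trial_v_def)
  show "trial_gamma \<tau> \<mu>f \<mu>g L \<gamma>
      = (1 - trial_alpha \<tau> \<mu>f \<mu>g L \<gamma>) * \<gamma> + trial_alpha \<tau> \<mu>f \<mu>g L \<gamma> * \<mu>"
    by (rule trial_gamma_def)
  show "trial_gamma \<tau> \<mu>f \<mu>g L \<gamma> = L * (trial_alpha \<tau> \<mu>f \<mu>g L \<gamma>)\<^sup>2"
    by (rule trial_gamma_eq[OF L \<gamma>(1)])
  show "0 \<le> trial_alpha \<tau> \<mu>f \<mu>g L \<gamma>"
    by (rule trial_alpha_nonneg[OF L \<gamma>(1)])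
qed (rule L \<alpha> \<gamma>(1) mu_hat_nonneg accepted_lower_bound[OF L acc])+

section \<open>Executions\<close>

lemma accepted_large_estimate:
  assumes "Lf + \<tau> * \<mu>g \<le> L"
  shows "accepted f g \<tau> \<mu>f \<mu>g x0 L \<gamma> x v"
proof -
  have "fh z \<le> fh y + grad fh y \<bullet> (z - y) + L / 2 * (norm (z - y))\<^sup>2" for y z
  proof -
    have "(Lf + \<tau> * \<mu>g) / 2 * (norm (z - y))\<^sup>2 \<le> L / 2 * (norm (z - y))\<^sup>2"
      using assms by (intro mult_right_mono) auto
    then show ?thesis
      using f_hat_descent[of z y] by linarith
  qed
  then show ?thesis
    by (simp add: accepted_def objective_split model_def)
qed

lemma line_search_terminates:
  assumes "0 < L" "1 < \<eta>u" "0 < \<eta>d"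
  obtains i where "accepted f g \<tau> \<mu>f \<mu>g x0 (\<eta>u ^ i * \<eta>d * L) \<gamma> x v"
    and "\<And>j. j < i \<Longrightarrow> \<not> accepted f g \<tau> \<mu>f \<mu>g x0 (\<eta>u ^ j * \<eta>d * L) \<gamma> x v"
proof -
  obtain n where "(Lf + \<tau> * \<mu>g) / (\<eta>d * L) < \<eta>u ^ n"
    using real_arch_pow[OF assms(2)] by blast
  then have "Lf + \<tau> * \<mu>g \<le> \<eta>u ^ n * \<eta>d * L"
    using assms by (simp add: field_simps)
  from accepted_large_estimate[OF this]
  have "\<exists>i. accepted f g \<tau> \<mu>f \<mu>g x0 (\<eta>u ^ i * \<eta>d * L) \<gamma> x v"
    by blast
  from this[unfolded exists_least_iff[of "\<lambda>i. accepted f g \<tau> \<mu>f \<mu>g x0 (\<eta>u ^ i * \<eta>d * L) \<gamma> x v"]] that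
  show ?thesis
    by blast
qed

lemma ex_comet_run:
  assumes "0 < L0" "1 < \<eta>u" "0 < \<eta>d"
  shows "\<exists>x y v L \<gamma> \<alpha>. comet_run f g \<tau> \<mu>f \<mu>g x0 L0 \<gamma>0 \<eta>u \<eta>d x y v L \<gamma> \<alpha>"
proof -
  \<comment> \<open>A state is \<open>(x, v, L, \<gamma>)\<close>; \<open>y\<close> and \<open>\<alpha>\<close> are functions of two consecutive states.\<close>
  let ?P = "\<lambda>n (x, v, L, \<gamma>). 0 < L \<and> (n = (0::nat) \<longrightarrow> x = x0 \<and> v = x0 \<and> L = L0 \<and> \<gamma> = \<gamma>0)"
  let ?Q = "\<lambda>n (x, v, L, \<gamma>) (x', v', L', \<gamma>'). \<exists>i::nat.
        accepted f g \<tau> \<mu>f \<mu>g x0 (\<eta>u ^ i * \<eta>d * L) \<gamma> x v \<and>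
        (\<forall>j<i. \<not> accepted f g \<tau> \<mu>f \<mu>g x0 (\<eta>u ^ j * \<eta>d * L) \<gamma> x v) \<and>
        L' = \<eta>u ^ i * \<eta>d * L \<and>
        x' = trial_x f g \<tau> \<mu>f \<mu>g x0 L' \<gamma> x v \<and>
        v' = trial_v f g \<tau> \<mu>f \<mu>g x0 L' \<gamma> x v \<and>
        \<gamma>' = trial_gamma \<tau> \<mu>f \<mu>g L' \<gamma>"
  have "\<exists>s. \<forall>n. ?P n (s n) \<and> ?Q n (s n) (s (Suc n))"
  proof (rule dependent_nat_choice)
    show "\<exists>s. ?P 0 s"
      using assms by auto
  next
    fix s n
    assume "?P n s"
    moreover obtain x v L \<gamma> where s: "s = (x, v, L, \<gamma>)"
      by (cases s)
    ultimately have L: "0 < L"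
      by simp
    obtain i where i: "accepted f g \<tau> \<mu>f \<mu>g x0 (\<eta>u ^ i * \<eta>d * L) \<gamma> x v"
        "\<And>j. j < i \<Longrightarrow> \<not> accepted f g \<tau> \<mu>f \<mu>g x0 (\<eta>u ^ j * \<eta>d * L) \<gamma> x v"
      using line_search_terminates[OF L assms(2,3)] by blast
    let ?L = "\<eta>u ^ i * \<eta>d * L"
    let ?s' = "(trial_x f g \<tau> \<mu>f \<mu>g x0 ?L \<gamma> x v, trial_v f g \<tau> \<mu>f \<mu>g x0 ?L \<gamma> x v,
                ?L, trial_gamma \<tau> \<mu>f \<mu>g ?L \<gamma>)"
    have "?P (Suc n) ?s' \<and> ?Q n s ?s'"
      using i L assms unfolding s by auto
    then show "\<exists>s'. ?P (Suc n) s' \<and> ?Q n s s'"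
      by blast
  qed
  then obtain s where s: "\<forall>n. ?P n (s n) \<and> ?Q n (s n) (s (Suc n))"
    by (elim exE)
  have P: "?P n (s n)" and Q: "?Q n (s n) (s (Suc n))" for n
    using spec[OF s, of n] by (rule conjunct1, rule conjunct2)
  let ?x = "\<lambda>n. fst (s n)" and ?v = "\<lambda>n. fst (snd (s n))"
    and ?L = "\<lambda>n. fst (snd (snd (s n)))" and ?\<gamma> = "\<lambda>n. snd (snd (snd (s n)))"
  have "comet_run f g \<tau> \<mu>f \<mu>g x0 L0 \<gamma>0 \<eta>u \<eta>d ?x
      (\<lambda>n. trial_y \<tau> \<mu>f \<mu>g (?L (Suc n)) (?\<gamma> n) (?x n) (?v n)) ?v ?L ?\<gamma>
      (\<lambda>n. trial_alpha \<tau> \<mu>f \<mu>g (?L (Suc n)) (?\<gamma> n))"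
    unfolding comet_run_def
  proof (intro conjI allI)
    show "?x 0 = x0" "?v 0 = x0" "?L 0 = L0" "?\<gamma> 0 = \<gamma>0"
      using P[of 0] by (simp_all add: case_prod_beta)
  qed (use Q in \<open>simp only: case_prod_beta simp_thms\<close>)
  then show ?thesis
    by blast
qed

end

locale comet_execution = composite_problem f g Lf \<mu>f \<mu>g \<tau> x0
  for f g :: "real^'n \<Rightarrow> real" and Lf \<mu>f \<mu>g \<tau> :: real and x0 :: "real^'n" +
  fixes L0 \<gamma>0 \<eta>u \<eta>d :: real and x y v :: "nat \<Rightarrow> real^'n" and L \<gamma> \<alpha> :: "nat \<Rightarrow> real"
  assumes L0_pos: "0 < L0" and \<gamma>0_nonneg: "0 \<le> \<gamma>0" and nondegenerate: "\<not> (\<gamma>0 = 0 \<and> \<mu> = 0)"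
    and \<eta>u: "1 < \<eta>u" and \<eta>d: "0 < \<eta>d"
    and run: "comet_run f g \<tau> \<mu>f \<mu>g x0 L0 \<gamma>0 \<eta>u \<eta>d x y v L \<gamma> \<alpha>"
begin

lemma initial: "x 0 = x0" "v 0 = x0" "L 0 = L0" "\<gamma> 0 = \<gamma>0"
  using run by (auto simp: comet_run_def)

lemma iteration:
  "accepted f g \<tau> \<mu>f \<mu>g x0 (L (Suc k)) (\<gamma> k) (x k) (v k)"
  "\<exists>i. L (Suc k) = \<eta>u ^ i * \<eta>d * L k"
  "x (Suc k) = trial_x f g \<tau> \<mu>f \<mu>g x0 (L (Suc k)) (\<gamma> k) (x k) (v k)"
  "v (Suc k) = trial_v f g \<tau> \<mu>f \<mu>g x0 (L (Suc k)) (\<gamma> k) (x k) (v k)"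
  "\<gamma> (Suc k) = trial_gamma \<tau> \<mu>f \<mu>g (L (Suc k)) (\<gamma> k)"
  "\<alpha> k = trial_alpha \<tau> \<mu>f \<mu>g (L (Suc k)) (\<gamma> k)"
  "y k = trial_y \<tau> \<mu>f \<mu>g (L (Suc k)) (\<gamma> k) (x k) (v k)"
proof -
  obtain i where "accepted f g \<tau> \<mu>f \<mu>g x0 (\<eta>u ^ i * \<eta>d * L k) (\<gamma> k) (x k) (v k) \<and>
        L (Suc k) = \<eta>u ^ i * \<eta>d * L k \<and>
        x (Suc k) = trial_x f g \<tau> \<mu>f \<mu>g x0 (L (Suc k)) (\<gamma> k) (x k) (v k) \<and>
        v (Suc k) = trial_v f g \<tau> \<mu>f \<mu>g x0 (L (Suc k)) (\<gamma> k) (x k) (v k) \<and>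
        \<gamma> (Suc k) = trial_gamma \<tau> \<mu>f \<mu>g (L (Suc k)) (\<gamma> k) \<and>
        \<alpha> k = trial_alpha \<tau> \<mu>f \<mu>g (L (Suc k)) (\<gamma> k) \<and>
        y k = trial_y \<tau> \<mu>f \<mu>g (L (Suc k)) (\<gamma> k) (x k) (v k)"
    using run unfolding comet_run_def by blast
  then show "accepted f g \<tau> \<mu>f \<mu>g x0 (L (Suc k)) (\<gamma> k) (x k) (v k)"
    "\<exists>i. L (Suc k) = \<eta>u ^ i * \<eta>d * L k"
    "x (Suc k) = trial_x f g \<tau> \<mu>f \<mu>g x0 (L (Suc k)) (\<gamma> k) (x k) (v k)"
    "v (Suc k) = trial_v f g \<tau> \<mu>f \<mu>g x0 (L (Suc k)) (\<gamma> k) (x k) (v k)"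
    "\<gamma> (Suc k) = trial_gamma \<tau> \<mu>f \<mu>g (L (Suc k)) (\<gamma> k)"
    "\<alpha> k = trial_alpha \<tau> \<mu>f \<mu>g (L (Suc k)) (\<gamma> k)"
    "y k = trial_y \<tau> \<mu>f \<mu>g (L (Suc k)) (\<gamma> k) (x k) (v k)"
    by auto
qed

lemma L_pos: "0 < L k"
proof (induction k)
  case (Suc k)
  then show ?case
    using iteration(2)[of k] \<eta>u \<eta>d by auto
qed (simp add: initial L0_pos)

lemma \<gamma>_nonneg: "0 \<le> \<gamma> k"
  by (induction k) (simp_all add: initial \<gamma>0_nonneg iteration(5) trial_gamma_nonneg L_pos)

text \<open>After one iteration \<open>\<gamma>\<close> is positive, so that the assumption on the initial values persists and
  no divisor \<open>trial_gamma\<close> ever vanishes.\<close>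

lemma \<gamma>_nondegenerate: "\<not> (\<gamma> k = 0 \<and> \<mu> = 0)"
proof (induction k)
  case (Suc k)
  then have "0 < \<gamma> (Suc k)"
    unfolding iteration(5) by (rule trial_gamma_pos[OF L_pos \<gamma>_nonneg mu_hat_nonneg])
  then show ?case
    by simp
qed (use initial nondegenerate in simp)

lemma alpha_gt_1_imp_minimizer:
  assumes "1 < \<alpha> j"
  shows "y j = x (Suc j) \<and> minimizer F (x (Suc j))"
proof -
  have "L (Suc j) < \<mu>"
    using assms trial_alpha_gt_1D[OF L_pos \<gamma>_nonneg] by (simp add: iteration(6))
  from accepted_small_estimate[OF L_pos this iteration(1)] show ?thesis
    by (simp add: iteration(3)[of j] iteration(7)[of j])
qed

lemma potential_bound:
  assumes "\<And>j. j < k \<Longrightarrow> \<alpha> j \<le> 1"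
  shows "F (x k) - F z + \<gamma> k / 2 * (norm (v k - z))\<^sup>2
           \<le> (\<Prod>i<k. 1 - \<alpha> i) * (F x0 - F z + \<gamma>0 / 2 * (norm (x0 - z))\<^sup>2)"
  using assms
proof (induction k)
  case 0
  show ?case
    by (simp add: initial)
next
  case (Suc k)
  let ?E = "\<lambda>k. F (x k) - F z + \<gamma> k / 2 * (norm (v k - z))\<^sup>2"
  have \<alpha>: "\<alpha> k \<le> 1"
    using Suc.prems by simp
  have "?E (Suc k) \<le> (1 - \<alpha> k) * ?E k"
    using accepted_potential_contraction[OF L_pos \<gamma>_nonneg \<gamma>_nondegenerate iteration(1)] \<alpha>
    unfolding iteration(3,4,5,6) by blast
  also have "\<dots> \<le> (1 - \<alpha> k)
      * ((\<Prod>i<k. 1 - \<alpha> i) * (F x0 - F z + \<gamma>0 / 2 * (norm (x0 - z))\<^sup>2))"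
    using Suc \<alpha> by (intro mult_left_mono) auto
  finally show ?case
    by (simp add: mult_ac)
qed

lemma rate:
  "F (x k) - F z \<le> (\<Prod>i<k. 1 - \<alpha> i) * (F x0 - F z + \<gamma>0 / 2 * (norm (x0 - z))\<^sup>2)
   \<or> (\<exists>j<k. 1 < \<alpha> j \<and> y j = x (Suc j) \<and> minimizer F (x (Suc j)))"
proof (cases "\<exists>j<k. 1 < \<alpha> j")
  case True
  then show ?thesis
    using alpha_gt_1_imp_minimizer by blast
next
  case False
  have "0 \<le> \<gamma> k / 2 * (norm (v k - z))\<^sup>2"
    using \<gamma>_nonneg by simp
  then show ?thesis
    using potential_bound[of k z] False by force
qed

end

theorem theorem2:
  fixes f g :: "real^'n \<Rightarrow> real"
    and Lf \<mu>f \<mu>g \<tau> L0 \<gamma>0 \<eta>u \<eta>d :: real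
    and x0 xs :: "real^'n"
  assumes "0 \<le> \<mu>f" and "\<mu>f \<le> Lf"
    and "smooth_fun Lf f" and "strongly_convex \<mu>f f"
    and "convex_on UNIV g" and "lower_semicontinuous g"
    and "0 \<le> \<mu>g" and "strongly_convex \<mu>g g"
    and "0 < \<tau>"
    and "0 < L0" and "\<gamma>0 \<in> {0 .. 3 * L0 + mu_hat \<tau> \<mu>f \<mu>g}"
    and "\<not> (\<gamma>0 = 0 \<and> mu_hat \<tau> \<mu>f \<mu>g = 0)"
    and "1 < \<eta>u" and "\<eta>d \<in> {0<..<1}"
    and "minimizer (objective f g \<tau>) xs"
  shows
    "(\<forall>L>0. \<forall>y. \<exists>!z. minimizer (model f g \<tau> \<mu>g x0 L y) z) \<and>
     (\<exists>x y v L \<gamma> \<alpha>. comet_run f g \<tau> \<mu>f \<mu>g x0 L0 \<gamma>0 \<eta>u \<eta>d x y v L \<gamma> \<alpha>) \<and>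
     (\<forall>x y v L \<gamma> \<alpha>. comet_run f g \<tau> \<mu>f \<mu>g x0 L0 \<gamma>0 \<eta>u \<eta>d x y v L \<gamma> \<alpha> \<longrightarrow>
        (\<forall>k.
           objective f g \<tau> (x k) - objective f g \<tau> xs
             \<le> (\<Prod>i<k. 1 - \<alpha> i) *
               (objective f g \<tau> x0 - objective f g \<tau> xs + \<gamma>0 / 2 * (norm (x0 - xs))\<^sup>2)
           \<or> (\<exists>j<k. 1 < \<alpha> j \<and> y j = x (Suc j) \<and> minimizer (objective f g \<tau>) (x (Suc j)))))"
proof -
  interpret composite_problem f g Lf \<mu>f \<mu>g \<tau> x0
    by unfold_locales (use assms in auto)
  have "F (x k) - F xs \<le> (\<Prod>i<k. 1 - \<alpha> i) * (F x0 - F xs + \<gamma>0 / 2 * (norm (x0 - xs))\<^sup>2)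
      \<or> (\<exists>j<k. 1 < \<alpha> j \<and> y j = x (Suc j) \<and> minimizer F (x (Suc j)))"
    if "comet_run f g \<tau> \<mu>f \<mu>g x0 L0 \<gamma>0 \<eta>u \<eta>d x y v L \<gamma> \<alpha>" for x y v L \<gamma> \<alpha> k
  proof -
    interpret comet_execution f g Lf \<mu>f \<mu>g \<tau> x0 L0 \<gamma>0 \<eta>u \<eta>d x y v L \<gamma> \<alpha>
      by unfold_locales (use assms that in auto)
    show ?thesis
      by (rule rate)
  qed
  moreover have "\<exists>x y v L \<gamma> \<alpha>. comet_run f g \<tau> \<mu>f \<mu>g x0 L0 \<gamma>0 \<eta>u \<eta>d x y v L \<gamma> \<alpha>"
    using assms by (intro ex_comet_run) auto
  ultimately show ?thesis
    using ex1_minimizer_model by blast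
qed

end
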